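(* Let $g_1, \ldots, g_n$ be positions in impartial games, each of which is a one-move game. Then $$\mathcal{G}(C_{(+, \mathrm{pass})}(g_1, \ldots, g_n)) = \mathcal{G}\big(C^{\mathrm{nim}}_{(+, \mathrm{pass})}(\mathcal{G}(g_1), \ldots, \mathcal{G}(g_n))\big).$$
   Context: All games are impartial two-player games under normal play: the player with no legal move loses. Every game is finite, i.e. each position has finitely many options and every play terminates. For a position $g$, $\mathrm{move}(g)$ denotes its set of options, i.e. the positions reachable in one move. A follower of $g$ is any position reachable from $g$ by a sequence of zero or more moves, so $g$ is a follower of itself. A terminal position is one with no options. The Sprague–Grundy value is defined recursively by $\mathcal{G}(g)=\mathrm{mex}\{\mathcal{G}(h): h\in\mathrm{move}(g)\}$, where $\mathrm{mex}(S)$ is the least nonnegative integer not in $S$. The disjunctive compound $C_+(g_1,\dots,g_n)$ has as options exactly the positions $C_+(g_1',\dots,g_n')$ such that, for some $i$, $g_i'\in\mathrm{move}(g_i)$ and $g_j'=g_j$ for all $j\neq i$. The one-pass compound $C_{(+,\mathrm{pass})}(g_1,\dots,g_n)$ is defined as follows. - If every $g_i$ is terminal, it has no options. - Otherwise, its options are all $C_{(+,\mathrm{pass})}(g_1',\dots,g_n')$ such that, for some $i$, $g_i'\in\mathrm{move}(g_i)$ and $g_j'=g_j$ for $j\ne i$, together with the single further option $C_+(g_1,\dots,g_n)$. This last option is the pass move. A position $g$ is a one-move game if, for every follower $g'$ of $g$, $\mathcal{G}(g')=0$ if and only if $g'$ is terminal. For nonnegative integers $m_1,\dots,m_n$, $C^{\mathrm{nim}}_{(+,\mathrm{pass})}(m_1,\dots,m_n)$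 denotes the one-pass compound whose $i$-th component is single-pile Nim with $m_i$ tokens. In single-pile Nim with $m$ tokens, the options are single piles with $m'$ tokens for each $0\le m'<m$. *)

theory Defs
  imports Main
begin

text \<open>
  A game is given by its option function \<open>mv\<close>, mapping a position to the set of its options.
\<close>

definition impartial_game :: "('a \<Rightarrow> 'a set) \<Rightarrow> bool" where
  "impartial_game mv \<longleftrightarrow> (\<forall>g. finite (mv g)) \<and> wf {(h, g). h \<in> mv g}"

definition terminal :: "('a \<Rightarrow> 'a set) \<Rightarrow> 'a \<Rightarrow> bool" where
  "terminal mv g \<longleftrightarrow> mv g = {}"

definition follower :: "('a \<Rightarrow> 'a set) \<Rightarrow> 'a \<Rightarrow> 'a \<Rightarrow> bool" where
  "follower mv g h \<longleftrightarrow> (\<lambda>x y. y \<in> mv x)\<^sup>*\<^sup>* g h"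

definition mex :: "nat set \<Rightarrow> nat" where
  "mex S = (LEAST n. n \<notin> S)"

text \<open>Meaningful for \<^const>\<open>impartial_game\<close>s only; see \<open>grundy_rec\<close> below.\<close>

definition grundy :: "('a \<Rightarrow> 'a set) \<Rightarrow> 'a \<Rightarrow> nat" where
  "grundy mv = wfrec {(h, g). h \<in> mv g} (\<lambda>G g. mex (G ` mv g))"

definition one_move_game :: "('a \<Rightarrow> 'a set) \<Rightarrow> 'a \<Rightarrow> bool" where
  "one_move_game mv g \<longleftrightarrow>
     (\<forall>h. follower mv g h \<longrightarrow> (grundy mv h = 0 \<longleftrightarrow> terminal mv h))"

text \<open>
  The components of a compound are indexed by a finite type \<open>'n\<close>. Each component has its own
  option function; components with different kinds of positions are covered by taking \<open>'a\<close>
  to be a sum type.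
\<close>

definition disj_moves :: "('n \<Rightarrow> 'a \<Rightarrow> 'a set) \<Rightarrow> ('n \<Rightarrow> 'a) \<Rightarrow> ('n \<Rightarrow> 'a) set" where
  "disj_moves mv g = {g(i := h) | i h. h \<in> mv i (g i)}"

text \<open>
  \<open>Pass_Available g\<close> is the one-pass compound of the components \<open>g\<close>; \<open>Pass_Used g\<close> is the
  position reached from it by the pass move, which is a copy of the disjunctive compound of \<open>g\<close>
  (see \<open>grundy_Pass_Used\<close>).
\<close>

datatype 'p one_pass_position = Pass_Available 'p | Pass_Used 'p

primrec one_pass_moves ::
  "('n \<Rightarrow> 'a \<Rightarrow> 'a set) \<Rightarrow> ('n \<Rightarrow> 'a) one_pass_position \<Rightarrow> ('n \<Rightarrow> 'a) one_pass_position set" where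
  "one_pass_moves mv (Pass_Available g) =
     (if \<forall>i. terminal (mv i) (g i) then {}
      else Pass_Available ` disj_moves mv g \<union> {Pass_Used g})"
| "one_pass_moves mv (Pass_Used g) = Pass_Used ` disj_moves mv g"

definition nim_moves :: "nat \<Rightarrow> nat set" where
  "nim_moves m = {m'. m' < m}"

lemma grundy_rec:
  assumes "impartial_game mv"
  shows "grundy mv g = mex (grundy mv ` mv g)"
proof -
  let ?R = "{(h, g). h \<in> mv g}"
  have wf: "wf ?R" using assms by (simp add: impartial_game_def)
  have "grundy mv g = mex (cut (grundy mv) ?R g ` mv g)"
    unfolding grundy_def by (subst wfrec[OF wf]) simp
  also have "cut (grundy mv) ?R g ` mv g = grundy mv ` mv g"
    by (rule image_cong) (auto simp: cut_apply)
  finally show ?thesis .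
qed

lemma impartial_game_rank:
  assumes "impartial_game mv"
  obtains r :: "'a \<Rightarrow> nat" where "\<And>g h. h \<in> mv g \<Longrightarrow> r h < r g"
proof -
  let ?R = "{(h, g). h \<in> mv g}"
  define r where "r = wfrec ?R (\<lambda>r g. \<Sum>h\<in>mv g. Suc (r h))"
  have wf: "wf ?R" and fin: "\<And>g. finite (mv g)" using assms by (auto simp: impartial_game_def)
  have rec: "r g = (\<Sum>h\<in>mv g. Suc (r h))" for g
  proof -
    have "r g = (\<Sum>h\<in>mv g. Suc (cut r ?R g h))"
      unfolding r_def by (subst wfrec[OF wf]) simp
    also have "\<dots> = (\<Sum>h\<in>mv g. Suc (r h))"
      by (rule sum.cong) (auto simp: cut_apply)
    finally show ?thesis .
  qed
  have "r h < r g" if "h \<in> mv g" for g h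
  proof -
    have "Suc (r h) \<le> (\<Sum>h\<in>mv g. Suc (r h))"
      by (rule member_le_sum[OF that]) (auto simp: fin)
    then show ?thesis using rec[of g] by simp
  qed
  then show ?thesis using that by blast
qed

lemma finite_disj_moves:
  fixes mv :: "'n::finite \<Rightarrow> 'a \<Rightarrow> 'a set"
  assumes "\<And>i. impartial_game (mv i)"
  shows "finite (disj_moves mv g)"
proof -
  have "disj_moves mv g = (\<Union>i. (\<lambda>h. g(i := h)) ` mv i (g i))"
    by (auto simp: disj_moves_def)
  then show ?thesis using assms by (simp add: impartial_game_def)
qed

lemma disj_moves_rank:
  fixes mv :: "'n::finite \<Rightarrow> 'a \<Rightarrow> 'a set"
  assumes "\<And>i. impartial_game (mv i)"
  shows "\<exists>R :: ('n \<Rightarrow> 'a) \<Rightarrow> nat. \<forall>g h. h \<in> disj_moves mv g \<longrightarrow> R h < R g"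
proof -
  have "\<exists>r :: 'a \<Rightarrow> nat. \<forall>g h. h \<in> mv i g \<longrightarrow> r h < r g" for i
    by (rule impartial_game_rank[OF assms[of i]]) blast
  then obtain r :: "'n \<Rightarrow> 'a \<Rightarrow> nat" where r: "\<And>i g h. h \<in> mv i g \<Longrightarrow> r i h < r i g"
    by metis
  have "(\<Sum>i\<in>UNIV. r i (h i)) < (\<Sum>i\<in>UNIV. r i (g i))" if "h \<in> disj_moves mv g" for g h
  proof -
    from that obtain i x where h: "h = g(i := x)" and x: "x \<in> mv i (g i)"
      by (auto simp: disj_moves_def)
    show ?thesis
      by (rule sum_strict_mono_ex1) (auto simp: h r[OF x] intro!: less_imp_le exI[of _ i])
  qed
  then show ?thesis by (intro exI[of _ "\<lambda>g. \<Sum>i\<in>UNIV. r i (g i)"]) blast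
qed

lemma impartial_game_disj_moves:
  fixes mv :: "'n::finite \<Rightarrow> 'a \<Rightarrow> 'a set"
  assumes "\<And>i. impartial_game (mv i)"
  shows "impartial_game (disj_moves mv)"
proof -
  obtain R :: "('n \<Rightarrow> 'a) \<Rightarrow> nat" where R: "\<And>g h. h \<in> disj_moves mv g \<Longrightarrow> R h < R g"
    using disj_moves_rank[of mv, OF assms] by blast
  then have "wf {(h, g). h \<in> disj_moves mv g}"
    by (intro wf_subset[OF wf_measure[of R]]) auto
  then show ?thesis using finite_disj_moves[of mv, OF assms] by (simp add: impartial_game_def)
qed

lemma impartial_game_one_pass_moves:
  fixes mv :: "'n::finite \<Rightarrow> 'a \<Rightarrow> 'a set"
  assumes "\<And>i. impartial_game (mv i)"
  shows "impartial_game (one_pass_moves mv)"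
proof -
  obtain R :: "('n \<Rightarrow> 'a) \<Rightarrow> nat" where R: "\<And>g h. h \<in> disj_moves mv g \<Longrightarrow> R h < R g"
    using disj_moves_rank[of mv, OF assms] by blast
  define Q where
    "Q p = (case p of Pass_Available g \<Rightarrow> Suc (2 * R g) | Pass_Used g \<Rightarrow> 2 * R g)" for p
  have "Q q < Q p" if "q \<in> one_pass_moves mv p" for p q
    using that by (cases p) (auto simp: Q_def R split: if_splits)
  then have "wf {(q, p). q \<in> one_pass_moves mv p}"
    by (intro wf_subset[OF wf_measure[of Q]]) auto
  moreover have "finite (one_pass_moves mv p)" for p
    by (cases p) (auto simp: finite_disj_moves[of mv, OF assms])
  ultimately show ?thesis by (simp add: impartial_game_def)
qed

lemma impartial_game_nim_moves: "impartial_game nim_moves"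
  using wf_less by (simp add: impartial_game_def nim_moves_def)

lemma grundy_Pass_Used:
  fixes mv :: "'n::finite \<Rightarrow> 'a \<Rightarrow> 'a set"
  assumes "\<And>i. impartial_game (mv i)"
  shows "grundy (one_pass_moves mv) (Pass_Used g) = grundy (disj_moves mv) g"
proof -
  have D: "impartial_game (disj_moves mv)" and P: "impartial_game (one_pass_moves mv)"
    using assms by (rule impartial_game_disj_moves, rule impartial_game_one_pass_moves)
  have "wf {(h, g). h \<in> disj_moves mv g}" using D by (simp add: impartial_game_def)
  then show ?thesis
  proof (induction g rule: wf_induct_rule)
    case (less g)
    then have "(\<lambda>h. grundy (one_pass_moves mv) (Pass_Used h)) ` disj_moves mv g
        = grundy (disj_moves mv) ` disj_moves mv g"
      by (intro image_cong) auto
    then show ?case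
      by (simp add: grundy_rec[OF P, of "Pass_Used g"] grundy_rec[OF D, of g] image_image)
  qed
qed

end

theory Submission
  imports Defs
begin

text \<open>
  Let a map of positions lift every move of its target, and send every move of its source either to
  a move or to the reverse of one. Such a map preserves Sprague--Grundy values: a reversed move
  leads to a value different from the current one, so it does not affect the mex. Taking values maps
  any game to Nim in this way, and such maps combine componentwise to disjunctive compounds. They
  extend to one-pass compounds if they reflect terminal positions, so that both compounds offer
  the pass at the same time; this is where the one-move condition is needed.
\<close>

lemma mex_notin:
  assumes "finite S"
  shows "mex S \<notin> S"
  unfolding mex_def using ex_new_if_finite[OF infinite_UNIV_nat assms] by (rule LeastI_ex)

lemma less_mex_in: "n < mex S \<Longrightarrow> n \<in> S"
  unfolding mex_def using not_less_Least by blast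

lemma mex_eqI:
  assumes "m \<notin> S" and "\<And>n. n < m \<Longrightarrow> n \<in> S"
  shows "mex S = m"
  unfolding mex_def using assms by (intro Least_equality) (auto simp: not_less[symmetric])

lemma grundy_option_neq:
  assumes "impartial_game mv" and "h \<in> mv g"
  shows "grundy mv h \<noteq> grundy mv g"
proof -
  have "mex (grundy mv ` mv g) \<notin> grundy mv ` mv g"
    using assms(1) by (intro mex_notin) (simp add: impartial_game_def)
  then show ?thesis using assms(2) grundy_rec[OF assms(1), of g] by force
qed

lemma less_grundy_obtain_option:
  assumes "impartial_game mv" and "n < grundy mv g"
  obtains h where "h \<in> mv g" and "grundy mv h = n"
  using less_mex_in[of n "grundy mv ` mv g"] assms(2) grundy_rec[OF assms(1), of g] by auto

locale reversible_map_on =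
  fixes S :: "'a set" and mv :: "'a \<Rightarrow> 'a set" and mv' :: "'b \<Rightarrow> 'b set" and f :: "'a \<Rightarrow> 'b"
  assumes option_closed: "\<And>g h. g \<in> S \<Longrightarrow> h \<in> mv g \<Longrightarrow> h \<in> S"
    and option_lift: "\<And>g k. g \<in> S \<Longrightarrow> k \<in> mv' (f g) \<Longrightarrow> \<exists>h\<in>mv g. f h = k"
    and option_reversible: "\<And>g h. g \<in> S \<Longrightarrow> h \<in> mv g \<Longrightarrow> f h \<in> mv' (f g) \<or> f g \<in> mv' (f h)"
begin

lemma terminal_image:
  assumes "g \<in> S" and "terminal mv g"
  shows "terminal mv' (f g)"
  using assms option_lift by (fastforce simp: terminal_def)

lemma grundy_image:
  assumes mv: "impartial_game mv" and mv': "impartial_game mv'" and "g \<in> S"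
  shows "grundy mv' (f g) = grundy mv g"
proof -
  have "wf {(h, g). h \<in> mv g}" using mv by (simp add: impartial_game_def)
  then show ?thesis using \<open>g \<in> S\<close>
  proof (induction g rule: wf_induct_rule)
    case (less g)
    have IH: "grundy mv' (f h) = grundy mv h" if "h \<in> mv g" for h
      using less that option_closed by blast
    have "mex (grundy mv ` mv g) = grundy mv' (f g)"
    proof (rule mex_eqI)
      show "grundy mv' (f g) \<notin> grundy mv ` mv g"
        using IH option_reversible[OF less.prems] grundy_option_neq[OF mv'] by (metis imageE)
    next
      fix n assume "n < grundy mv' (f g)"
      then obtain k where "k \<in> mv' (f g)" "grundy mv' k = n"
        by (rule less_grundy_obtain_option[OF mv'])
      then show "n \<in> grundy mv ` mv g"
        using option_lift[OF less.prems] IH by (metis imageI)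
    qed
    then show ?case by (simp add: grundy_rec[OF mv, of g])
  qed
qed

end

lemma reversible_map_on_grundy:
  assumes "impartial_game mv" and "\<And>g h. g \<in> S \<Longrightarrow> h \<in> mv g \<Longrightarrow> h \<in> S"
  shows "reversible_map_on S mv nim_moves (grundy mv)"
proof
  fix g k assume "k \<in> nim_moves (grundy mv g)"
  then have "k < grundy mv g" by (simp add: nim_moves_def)
  then show "\<exists>h\<in>mv g. grundy mv h = k"
    using less_grundy_obtain_option[OF assms(1)] by blast
next
  fix g h assume "h \<in> mv g"
  then have "grundy mv h \<noteq> grundy mv g" by (rule grundy_option_neq[OF assms(1)])
  then show "grundy mv h \<in> nim_moves (grundy mv g) \<or> grundy mv g \<in> nim_moves (grundy mv h)"
    by (auto simp: nim_moves_def)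
qed (fact assms(2))

lemma terminal_disj_moves_iff:
  "terminal (disj_moves mv) g \<longleftrightarrow> (\<forall>i. terminal (mv i) (g i))"
  by (auto simp: terminal_def disj_moves_def)

lemma fun_upd_in_disj_moves: "h \<in> mv i (g i) \<Longrightarrow> g(i := h) \<in> disj_moves mv g"
  by (auto simp: disj_moves_def)

lemma in_disj_moves_fun_upd: "g i \<in> mv i h \<Longrightarrow> g \<in> disj_moves mv (g(i := h))"
  using fun_upd_in_disj_moves[of "g i" mv i "g(i := h)"] by simp

lemma reversible_map_on_disj_moves:
  assumes "\<And>i. reversible_map_on (S i) (mv i) (mv' i) (f i)"
  shows "reversible_map_on {g. \<forall>i. g i \<in> S i} (disj_moves mv) (disj_moves mv') (\<lambda>g i. f i (g i))"
proof -
  let ?F = "\<lambda>g i. f i (g i)"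
  have F_fun_upd: "?F (g(i := x)) = (?F g)(i := f i x)" for g i x
    by auto
  show ?thesis
  proof
    fix g h assume "g \<in> {g. \<forall>i. g i \<in> S i}" and "h \<in> disj_moves mv g"
    then show "h \<in> {g. \<forall>i. g i \<in> S i}"
      using reversible_map_on.option_closed[OF assms] by (fastforce simp: disj_moves_def)
  next
    fix g k assume g: "g \<in> {g. \<forall>i. g i \<in> S i}" and "k \<in> disj_moves mv' (?F g)"
    then obtain i y where k: "k = (?F g)(i := y)" and y: "y \<in> mv' i (f i (g i))"
      by (auto simp: disj_moves_def)
    obtain x where "x \<in> mv i (g i)" and "f i x = y"
      using reversible_map_on.option_lift[OF assms _ y] g by blast
    then have "g(i := x) \<in> disj_moves mv g" and "?F (g(i := x)) = k"
      by (simp_all only: fun_upd_in_disj_moves F_fun_upd k)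
    then show "\<exists>h\<in>disj_moves mv g. ?F h = k" by (intro bexI[of _ "g(i := x)"])
  next
    fix g h assume g: "g \<in> {g. \<forall>i. g i \<in> S i}" and "h \<in> disj_moves mv g"
    then obtain i x where h: "h = g(i := x)" and x: "x \<in> mv i (g i)"
      by (auto simp: disj_moves_def)
    have "f i x \<in> mv' i (f i (g i)) \<or> f i (g i) \<in> mv' i (f i x)"
      using reversible_map_on.option_reversible[OF assms _ x] g by blast
    then show "?F h \<in> disj_moves mv' (?F g) \<or> ?F g \<in> disj_moves mv' (?F h)"
      unfolding h F_fun_upd by (auto intro: fun_upd_in_disj_moves in_disj_moves_fun_upd)
  qed
qed

lemma one_pass_moves_Pass_Available_iff:
  "q \<in> one_pass_moves mv (Pass_Available g) \<longleftrightarrow>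
     q \<in> Pass_Available ` disj_moves mv g \<or> q = Pass_Used g \<and> \<not> terminal (disj_moves mv) g"
  by (auto simp: terminal_disj_moves_iff[symmetric]) (auto simp: terminal_def)

declare one_pass_moves.simps(1) [simp del] one_pass_moves_Pass_Available_iff [simp]

lemma one_pass_option_lift:
  assumes disj: "reversible_map_on S (disj_moves mv) (disj_moves mv') f"
    and p: "set_one_pass_position p \<subseteq> S"
    and r: "r \<in> one_pass_moves mv' (map_one_pass_position f p)"
  shows "\<exists>q\<in>one_pass_moves mv p. map_one_pass_position f q = r"
proof (cases p)
  case (Pass_Available g)
  with p have "g \<in> S" by simp
  from r Pass_Available consider k where "r = Pass_Available k" "k \<in> disj_moves mv' (f g)"
    | "r = Pass_Used (f g)" "\<not> terminal (disj_moves mv') (f g)"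
    by auto
  then show ?thesis
  proof cases
    case (1 k)
    then obtain h where "h \<in> disj_moves mv g" "f h = k"
      using reversible_map_on.option_lift[OF disj \<open>g \<in> S\<close>] by blast
    then show ?thesis
      using 1 Pass_Available by (intro bexI[of _ "Pass_Available h"]) auto
  next
    case 2
    then have "\<not> terminal (disj_moves mv) g"
      using reversible_map_on.terminal_image[OF disj \<open>g \<in> S\<close>] by blast
    then show ?thesis
      using 2 Pass_Available by (intro bexI[of _ "Pass_Used g"]) auto
  qed
next
  case (Pass_Used g)
  then show ?thesis using p r reversible_map_on.option_lift[OF disj] by fastforce
qed

lemma reversible_map_on_one_pass_moves:
  assumes disj: "reversible_map_on S (disj_moves mv) (disj_moves mv') f"
    and terminal_reflect:
      "\<And>g. g \<in> S \<Longrightarrow> terminal (disj_moves mv') (f g) \<Longrightarrow> terminal (disj_moves mv) g"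
  shows "reversible_map_on {p. set_one_pass_position p \<subseteq> S}
    (one_pass_moves mv) (one_pass_moves mv') (map_one_pass_position f)"
proof
  fix p q assume "p \<in> {p. set_one_pass_position p \<subseteq> S}" and "q \<in> one_pass_moves mv p"
  then show "q \<in> {p. set_one_pass_position p \<subseteq> S}"
    using reversible_map_on.option_closed[OF disj] by (cases p) auto
next
  fix p r
  assume "p \<in> {p. set_one_pass_position p \<subseteq> S}"
    and "r \<in> one_pass_moves mv' (map_one_pass_position f p)"
  then show "\<exists>q\<in>one_pass_moves mv p. map_one_pass_position f q = r"
    using one_pass_option_lift[OF disj] by blast
next
  fix p q
  assume p: "p \<in> {p. set_one_pass_position p \<subseteq> S}" and q: "q \<in> one_pass_moves mv p"
  show "map_one_pass_position f q \<in> one_pass_moves mv' (map_one_pass_position f p) \<or>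
      map_one_pass_position f p \<in> one_pass_moves mv' (map_one_pass_position f q)"
  proof (cases p)
    case (Pass_Available g)
    then show ?thesis
      using p q reversible_map_on.option_reversible[OF disj] terminal_reflect[of g] by fastforce
  next
    case (Pass_Used g)
    then show ?thesis using p q reversible_map_on.option_reversible[OF disj] by fastforce
  qed
qed

lemma one_move_game_option:
  "one_move_game mv g \<Longrightarrow> h \<in> mv g \<Longrightarrow> one_move_game mv h"
  by (auto simp: one_move_game_def follower_def intro: converse_rtranclp_into_rtranclp)

lemma terminal_nim_moves_iff: "terminal nim_moves m \<longleftrightarrow> m = 0"
  by (auto simp: terminal_def nim_moves_def)

lemma one_move_game_terminal_nim_iff:
  "one_move_game mv g \<Longrightarrow> terminal nim_moves (grundy mv g) \<longleftrightarrow> terminal mv g"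
  by (simp add: terminal_nim_moves_iff one_move_game_def follower_def)

theorem theorem5:
  fixes mv :: "'n::finite \<Rightarrow> 'a \<Rightarrow> 'a set" and g :: "'n \<Rightarrow> 'a"
  assumes "\<And>i. impartial_game (mv i)"
    and "\<And>i. one_move_game (mv i) (g i)"
  shows "grundy (one_pass_moves mv) (Pass_Available g) =
         grundy (one_pass_moves (\<lambda>_. nim_moves)) (Pass_Available (\<lambda>i. grundy (mv i) (g i)))"
proof -
  let ?nim = "\<lambda>_ :: 'n. nim_moves"
  let ?S = "{h. \<forall>i. h i \<in> Collect (one_move_game (mv i))}"
  let ?V = "\<lambda>h i. grundy (mv i) (h i)"
  have "reversible_map_on (Collect (one_move_game (mv i))) (mv i) nim_moves (grundy (mv i))" for i
    using assms(1) by (rule reversible_map_on_grundy) (simp add: one_move_game_option)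
  then have "reversible_map_on ?S (disj_moves mv) (disj_moves ?nim) ?V"
    by (rule reversible_map_on_disj_moves)
  then have "reversible_map_on {p. set_one_pass_position p \<subseteq> ?S}
      (one_pass_moves mv) (one_pass_moves ?nim) (map_one_pass_position ?V)"
    by (rule reversible_map_on_one_pass_moves)
      (simp add: terminal_disj_moves_iff one_move_game_terminal_nim_iff)
  then have "grundy (one_pass_moves ?nim) (map_one_pass_position ?V (Pass_Available g)) =
      grundy (one_pass_moves mv) (Pass_Available g)"
    by (rule reversible_map_on.grundy_image)
      (simp_all add: assms impartial_game_one_pass_moves impartial_game_nim_moves)
  then show ?thesis by simp
qed

end
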